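(* Let $(X,\|\cdot\|)$ be a real Banach space and let $C\subset X$ be a (nonempty) closed bounded convex set. Then these two numbers coincide: (a) the infimum of the $\varepsilon>0$ such that there is a common bound for the heights of all the $\varepsilon$-separated dyadic trees contained in $C$; (b) the infimum of the $\varepsilon>0$ such that there is a bounded $\varepsilon$-uniformly convex function defined on $C$. Moreover, the number in (b) is the same if the function is in addition required to be convex and Lipschitz on $C$.
   Context: A dyadic tree of height $n\in\mathbb N$ is a family $\{x_s:|s|\le n\}\subset X$ indexed by finite sequences $s\in\bigcup_{k=0}^n\{0,1\}^k$ of length $|s|\le n$ such that $x_s=\frac12(x_{s\frown0}+x_{s\frown1})$ for every $|s|<n$, where $\frown$ is concatenation and $\{0,1\}^0=\{\emptyset\}$. It is $\varepsilon$-separated if $\|x_{s\frown0}-x_{s\frown1}\|\ge\varepsilon$ for every $|s|<n$. A function $f:C\to\mathbb R$ is $\varepsilon$-uniformly convex if there is $\delta>0$ such that $f\left(\frac{x+y}{2}\right)\le\frac{f(x)+f(y)}{2}-\delta$ whenever $x,y\in C$, $\|x-y\|\ge\varepsilon$; convexity of $f$ is not implied. Lipschitz is with respect to the norm. *)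

theory Defs
  imports "HOL-Analysis.Analysis"
begin

text \<open>
  Finite 0-1 sequences are boolean lists (False for 0, True for 1). A family indexed by the
  sequences of length at most n is a total function on boolean lists; its values at longer lists
  are irrelevant. The children of a node s are \<^term>\<open>s @ [False]\<close> and \<^term>\<open>s @ [True]\<close>.
\<close>

definition dyadic_tree :: "nat \<Rightarrow> (bool list \<Rightarrow> 'a::real_vector) \<Rightarrow> bool" where
  "dyadic_tree n x \<longleftrightarrow>
     (\<forall>s. length s < n \<longrightarrow> x s = (1/2) *\<^sub>R (x (s @ [False]) + x (s @ [True])))"

definition separated_tree :: "real \<Rightarrow> nat \<Rightarrow> (bool list \<Rightarrow> 'a::real_normed_vector) \<Rightarrow> bool" where
  "separated_tree \<epsilon> n x \<longleftrightarrow>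
     (\<forall>s. length s < n \<longrightarrow> norm (x (s @ [False]) - x (s @ [True])) \<ge> \<epsilon>)"

definition tree_in :: "nat \<Rightarrow> (bool list \<Rightarrow> 'a) \<Rightarrow> 'a set \<Rightarrow> bool" where
  "tree_in n x C \<longleftrightarrow> (\<forall>s. length s \<le> n \<longrightarrow> x s \<in> C)"

definition bounded_tree_heights :: "real \<Rightarrow> 'a::real_normed_vector set \<Rightarrow> bool" where
  "bounded_tree_heights \<epsilon> C \<longleftrightarrow>
     (\<exists>N::nat. \<forall>n x. dyadic_tree n x \<and> separated_tree \<epsilon> n x \<and> tree_in n x C \<longrightarrow> n \<le> N)"

definition eps_uniformly_convex_on ::
    "real \<Rightarrow> 'a::real_normed_vector set \<Rightarrow> ('a \<Rightarrow> real) \<Rightarrow> bool" where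
  "eps_uniformly_convex_on \<epsilon> C f \<longleftrightarrow>
     (\<exists>\<delta>>0. \<forall>x\<in>C. \<forall>y\<in>C. norm (x - y) \<ge> \<epsilon> \<longrightarrow>
        f ((1/2) *\<^sub>R (x + y)) \<le> (f x + f y) / 2 - \<delta>)"

end

theory Submission
  imports Defs
begin

text \<open>
  The sets of admissible \<open>\<epsilon>\<close> in (a) and (b) are equal, and passing to convex Lipschitz functions
  costs an arbitrarily small increase of \<open>\<epsilon>\<close>, which the infimum does not see.

  From functions to trees: along an \<open>\<epsilon>\<close>-separated tree every level gains \<open>\<delta>\<close>, so the value of a
  bounded function at the root lies at least \<open>n \<delta>\<close> below its supremum, which bounds the height \<open>n\<close>.

  From trees to functions: let \<open>h x\<close> be the largest height of an \<open>\<epsilon>\<close>-separated tree in \<open>C\<close> with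
  root \<open>x\<close>. Grafting two trees onto the midpoint of their roots shows
  \<open>h ((x + y) / 2) \<ge> min (h x) (h y) + 1\<close> whenever the roots are \<open>\<epsilon>\<close>-apart. This is only a
  quasi-convexity inequality, but composing with \<open>n \<mapsto> 2\<^sup>-\<^sup>n\<close> turns it into \<open>\<epsilon>\<close>-uniform
  convexity, since half the maximum of two numbers is their average minus half their minimum
  (\<open>uniformly_convex_function_of_bounded_trees\<close>).

  Convexity: take the convex envelope of a bounded \<open>\<epsilon>\<close>-uniformly convex \<open>f\<close>. If \<open>x\<close> and \<open>y\<close> are
  averages of points \<open>x\<^sub>i\<close> and \<open>y\<^sub>j\<close> of \<open>C\<close> and \<open>\<parallel>x - y\<parallel> \<ge> \<epsilon>' > \<epsilon>\<close>, then, \<open>C\<close> being bounded, a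
  fixed proportion of the pairs \<open>(x\<^sub>i, y\<^sub>j)\<close> is \<open>\<epsilon>\<close>-apart. Replacing just these pairs by their
  midpoints gains a fixed amount; the other pairs may be left alone, as the envelope
  admits arbitrary averages (\<open>convex_envelope_uniformly_convex\<close>).

  Lipschitz property: the infimal convolution of a convex \<open>f\<close> with \<open>K \<parallel>\<cdot>\<parallel>\<close> is convex and
  \<open>K\<close>-Lipschitz. For large \<open>K\<close> the infimum at \<open>x\<close> is attained, up to a small error, only close to
  \<open>x\<close>, so points at distance \<open>\<epsilon>'\<close> have near-minimizers at distance \<open>\<epsilon>\<close>
  (\<open>infimal_convolution_uniformly_convex\<close>).
\<close>

section \<open>Separated trees and bounded uniformly convex functions\<close>

lemma bounded_tree_heights_if_uniformly_convex:
  fixes f :: "'a::real_normed_vector \<Rightarrow> real"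
  assumes bdd: "bounded (f ` C)" and uc: "eps_uniformly_convex_on \<epsilon> C f"
  shows "bounded_tree_heights \<epsilon> C"
proof -
  obtain M where M: "\<And>x. x \<in> C \<Longrightarrow> \<bar>f x\<bar> \<le> M"
    using bdd by (auto simp: bounded_iff)
  obtain \<delta> where \<delta>: "\<delta> > 0" and
    mid: "\<And>x y. x \<in> C \<Longrightarrow> y \<in> C \<Longrightarrow> norm (x - y) \<ge> \<epsilon>
      \<Longrightarrow> f ((1/2) *\<^sub>R (x + y)) \<le> (f x + f y) / 2 - \<delta>"
    using uc by (auto simp: eps_uniformly_convex_on_def)
  have root: "f (x []) \<le> M - real n * \<delta>"
    if "dyadic_tree n x" "separated_tree \<epsilon> n x" "tree_in n x C" for n x
    using that
  proof (induction n arbitrary: x)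
    case 0
    then have "x [] \<in> C" by (auto simp: tree_in_def)
    then show ?case using M[of "x []"] by simp
  next
    case (Suc n)
    have sub: "f (x [b]) \<le> M - real n * \<delta>" for b
      using Suc.prems
      by (intro Suc.IH[of "\<lambda>s. x (b # s)", simplified])
        (auto simp: dyadic_tree_def separated_tree_def tree_in_def simp flip: append_Cons)
    have root_eq: "x [] = (1/2) *\<^sub>R (x [False] + x [True])"
      using Suc.prems(1) unfolding dyadic_tree_def
      by (metis append_Nil length_0_conv zero_less_Suc)
    have sep: "norm (x [False] - x [True]) \<ge> \<epsilon>"
      using Suc.prems(2) unfolding separated_tree_def
      by (metis append_Nil length_0_conv zero_less_Suc)
    have "x [b] \<in> C" for b
      using Suc.prems(3) by (auto simp: tree_in_def)
    from mid[OF this this sep] root_eq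
    have "f (x []) \<le> (f (x [False]) + f (x [True])) / 2 - \<delta>" by simp
    with sub[of False] sub[of True] show ?case by (simp add: algebra_simps)
  qed
  have "n \<le> nat \<lceil>2 * M / \<delta>\<rceil>"
    if tree: "dyadic_tree n x" "separated_tree \<epsilon> n x" "tree_in n x C" for n x
  proof -
    have "x [] \<in> C" using tree(3) by (auto simp: tree_in_def)
    then have "real n * \<delta> \<le> 2 * M" using M[of "x []"] root[OF tree] by simp
    then have "real n \<le> 2 * M / \<delta>" using \<delta> by (simp add: field_simps)
    then show ?thesis by linarith
  qed
  then show ?thesis unfolding bounded_tree_heights_def by blast
qed

definition separated_tree_at ::
    "real \<Rightarrow> 'a::real_normed_vector set \<Rightarrow> nat \<Rightarrow> 'a \<Rightarrow> bool" where
  "separated_tree_at \<epsilon> C n a \<longleftrightarrow>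
     (\<exists>x. dyadic_tree n x \<and> separated_tree \<epsilon> n x \<and> tree_in n x C \<and> x [] = a)"

lemma separated_tree_at_0: "a \<in> C \<Longrightarrow> separated_tree_at \<epsilon> C 0 a"
  unfolding separated_tree_at_def
  by (rule exI[of _ "\<lambda>_. a"]) (simp add: dyadic_tree_def separated_tree_def tree_in_def)

lemma separated_tree_at_mono:
  "separated_tree_at \<epsilon> C n a \<Longrightarrow> m \<le> n \<Longrightarrow> separated_tree_at \<epsilon> C m a"
  unfolding separated_tree_at_def dyadic_tree_def separated_tree_def tree_in_def
  by (elim ex_forward) auto

lemma separated_tree_at_midpoint:
  assumes C: "convex C"
    and a: "separated_tree_at \<epsilon> C n a" and b: "separated_tree_at \<epsilon> C n b"
    and far: "norm (a - b) \<ge> \<epsilon>"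
  shows "separated_tree_at \<epsilon> C (Suc n) ((1/2) *\<^sub>R (a + b))"
proof -
  obtain x where x: "dyadic_tree n x" "separated_tree \<epsilon> n x" "tree_in n x C" "x [] = a"
    using a by (auto simp: separated_tree_at_def)
  obtain y where y: "dyadic_tree n y" "separated_tree \<epsilon> n y" "tree_in n y C" "y [] = b"
    using b by (auto simp: separated_tree_at_def)
  define z where
    "z s = (case s of [] \<Rightarrow> (1/2) *\<^sub>R (a + b) | c # s' \<Rightarrow> if c then y s' else x s')" for s
  have "a \<in> C" "b \<in> C" using x y by (auto simp: tree_in_def)
  then have "(1/2) *\<^sub>R (a + b) \<in> C"
    using convexD[OF C, of a b "1/2" "1/2"] by (simp add: scaleR_add_right)
  then have "tree_in (Suc n) z C"
    using x(3) y(3) by (auto simp: tree_in_def z_def split: list.split)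
  moreover have "dyadic_tree (Suc n) z"
    unfolding dyadic_tree_def
  proof (intro allI impI)
    fix s :: "bool list"
    assume "length s < Suc n"
    then show "z s = (1/2) *\<^sub>R (z (s @ [False]) + z (s @ [True]))"
      using x(1,4) y(1,4) by (cases s) (auto simp: dyadic_tree_def z_def)
  qed
  moreover have "separated_tree \<epsilon> (Suc n) z"
    unfolding separated_tree_def
  proof (intro allI impI)
    fix s :: "bool list"
    assume "length s < Suc n"
    then show "norm (z (s @ [False]) - z (s @ [True])) \<ge> \<epsilon>"
      using x(2,4) y(2,4) far by (cases s) (auto simp: separated_tree_def z_def)
  qed
  moreover have "z [] = (1/2) *\<^sub>R (a + b)" by (simp add: z_def)
  ultimately show ?thesis unfolding separated_tree_at_def by blast
qed

text \<open>
  The function is \<open>2\<^sup>-\<^sup>h\<close>, where \<open>h x\<close> is the largest height of a tree rooted at \<open>x\<close>. The gain at a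
  midpoint is half the smaller of the two values, which is uniform because \<open>h\<close> is bounded.
\<close>

lemma uniformly_convex_function_of_bounded_trees:
  fixes C :: "'a::real_normed_vector set"
  assumes C: "convex C" and trees: "bounded_tree_heights \<epsilon> C"
  shows "\<exists>f::'a \<Rightarrow> real. bounded (f ` C) \<and> eps_uniformly_convex_on \<epsilon> C f"
proof -
  obtain N where N: "\<And>n a. separated_tree_at \<epsilon> C n a \<Longrightarrow> n \<le> N"
    using trees unfolding bounded_tree_heights_def separated_tree_at_def by blast
  define h where "h a = (GREATEST n. separated_tree_at \<epsilon> C n a)" for a
  have h_tree: "separated_tree_at \<epsilon> C (h a) a" if "a \<in> C" for a
    unfolding h_def using separated_tree_at_0[OF that] N by (rule GreatestI_nat)
  have h_max: "n \<le> h a" if "separated_tree_at \<epsilon> C n a" for n a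
    unfolding h_def using that N by (rule Greatest_le_nat)
  define f where "f a = (1/2::real) ^ h a" for a
  have f_le: "f a \<le> 1" for a unfolding f_def by (simp add: power_le_one)
  define p where "p = (1/2::real) ^ N"
  have f_ge: "p \<le> f a" if "a \<in> C" for a
    unfolding f_def p_def using N[OF h_tree[OF that]] by (intro power_decreasing) auto
  have "bounded (f ` C)"
    unfolding bounded_iff using f_le by (intro exI[of _ 1]) (auto simp: f_def)
  moreover have "f ((1/2) *\<^sub>R (x + y)) \<le> (f x + f y) / 2 - p / 2"
    if x: "x \<in> C" and y: "y \<in> C" and far: "norm (x - y) \<ge> \<epsilon>" for x y
  proof -
    define k where "k = min (h x) (h y)"
    have "separated_tree_at \<epsilon> C k x" "separated_tree_at \<epsilon> C k y"
      using h_tree x y separated_tree_at_mono unfolding k_def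
      by (metis min.cobounded1 min.cobounded2)+
    from h_max[OF separated_tree_at_midpoint[OF C this far]]
    have "f ((1/2) *\<^sub>R (x + y)) \<le> (1/2) ^ Suc k"
      unfolding f_def by (intro power_decreasing) auto
    also have "\<dots> = max (f x) (f y) / 2"
      by (auto simp: k_def min_def max_def f_def)
    also have "\<dots> \<le> (f x + f y) / 2 - p / 2"
      using f_ge[OF x] f_ge[OF y] by (simp add: max_def field_simps)
    finally show ?thesis .
  qed
  then have "eps_uniformly_convex_on \<epsilon> C f"
    unfolding eps_uniformly_convex_on_def by (intro exI[of _ "p / 2"]) (auto simp: p_def)
  ultimately show ?thesis by blast
qed

section \<open>Functions defined by the lower boundary of a convex set\<close>

text \<open>
  Both the convex envelope and the infimal convolution below are lower boundaries of convex subsets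
  of \<open>X \<times> \<real>\<close>; the lemmas of this section transfer properties of such a set to the function.
\<close>

definition lower_boundary :: "('a \<times> real) set \<Rightarrow> 'a \<Rightarrow> real" where
  "lower_boundary H x = Inf {t. (x, t) \<in> H}"

lemma lower_boundary_le:
  assumes "H \<subseteq> UNIV \<times> {m..}" and "(x, t) \<in> H"
  shows "lower_boundary H x \<le> t"
  unfolding lower_boundary_def using assms by (intro cInf_lower bdd_belowI) auto

lemma lower_boundary_ge:
  assumes "H \<subseteq> UNIV \<times> {m..}" and "(x, s) \<in> H"
  shows "m \<le> lower_boundary H x"
  unfolding lower_boundary_def using assms by (intro cInf_greatest) auto

lemma lower_boundary_approx:
  assumes "(x, s) \<in> H" and "lower_boundary H x < b"
  obtains t where "(x, t) \<in> H" and "t < b"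
  using cInf_lessD[of "{t. (x, t) \<in> H}" b] assms unfolding lower_boundary_def by auto

lemma bounded_lower_boundary:
  assumes "H \<subseteq> UNIV \<times> {m..}" and "\<forall>x\<in>C. \<exists>t<b. (x, t) \<in> H"
  shows "bounded (lower_boundary H ` C)"
proof -
  have "lower_boundary H x \<in> {m..b}" if x: "x \<in> C" for x
  proof -
    obtain t where "t < b" "(x, t) \<in> H" using assms(2) x by blast
    then show ?thesis
      using lower_boundary_le[OF assms(1)] lower_boundary_ge[OF assms(1)] by fastforce
  qed
  then show ?thesis by (meson bounded_closed_interval bounded_subset image_subsetI)
qed

lemma convex_on_lower_boundary:
  assumes C: "convex C" and H: "convex H"
    and below: "H \<subseteq> UNIV \<times> {m..}" and dom: "\<forall>x\<in>C. \<exists>t. (x, t) \<in> H"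
  shows "convex_on C (lower_boundary H)"
proof (rule convex_onI[OF _ C])
  fix l :: real and x y
  assume l: "0 < l" "l < 1" and x: "x \<in> C" and y: "y \<in> C"
  let ?g = "lower_boundary H"
  show "?g ((1 - l) *\<^sub>R x + l *\<^sub>R y) \<le> (1 - l) * ?g x + l * ?g y"
  proof (rule field_le_epsilon)
    fix e :: real
    assume e: "0 < e"
    obtain s where s: "(x, s) \<in> H" "s < ?g x + e"
      using dom x e lower_boundary_approx[of x _ H "?g x + e"] by auto
    obtain t where t: "(y, t) \<in> H" "t < ?g y + e"
      using dom y e lower_boundary_approx[of y _ H "?g y + e"] by auto
    have "((1 - l) *\<^sub>R x + l *\<^sub>R y, (1 - l) * s + l * t) \<in> H"
      using convexD[OF H s(1) t(1), of "1 - l" l] l by simp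
    then have "?g ((1 - l) *\<^sub>R x + l *\<^sub>R y) \<le> (1 - l) * s + l * t"
      by (rule lower_boundary_le[OF below])
    also have "\<dots> \<le> (1 - l) * (?g x + e) + l * (?g y + e)"
      using s(2) t(2) l by (intro add_mono mult_left_mono) auto
    finally show "?g ((1 - l) *\<^sub>R x + l *\<^sub>R y) \<le> (1 - l) * ?g x + l * ?g y + e"
      by (simp add: algebra_simps)
  qed
qed

text \<open>
  The midpoint inequality is required only for points of \<open>H\<close> below a level \<open>b\<close>: the infimum is
  approached by such points, and for the infimal convolution the inequality may fail above that level.
\<close>

lemma uniformly_convex_lower_boundary:
  assumes below: "H \<subseteq> UNIV \<times> {m..}" and dom: "\<forall>x\<in>C. \<exists>t<b. (x, t) \<in> H"
    and \<delta>: "\<delta> > 0"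
    and mid: "\<And>x y s t. x \<in> C \<Longrightarrow> y \<in> C \<Longrightarrow> (x, s) \<in> H \<Longrightarrow> (y, t) \<in> H \<Longrightarrow> s < b \<Longrightarrow> t < b
      \<Longrightarrow> norm (x - y) \<ge> \<epsilon> \<Longrightarrow> ((1/2) *\<^sub>R (x + y), (s + t) / 2 - \<delta>) \<in> H"
  shows "eps_uniformly_convex_on \<epsilon> C (lower_boundary H)"
  unfolding eps_uniformly_convex_on_def
proof (intro exI[of _ \<delta>] conjI \<delta> ballI impI)
  fix x y
  assume x: "x \<in> C" and y: "y \<in> C" and far: "norm (x - y) \<ge> \<epsilon>"
  let ?g = "lower_boundary H"
  have near: "\<exists>t. (z, t) \<in> H \<and> t < b \<and> t < ?g z + e" if z: "z \<in> C" and e: "e > 0" for z e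
  proof -
    obtain t where t: "t < b" "(z, t) \<in> H" using dom z by blast
    then have "?g z \<le> t" using lower_boundary_le[OF below] by blast
    then have "?g z < min b (?g z + e)" using t e by auto
    from lower_boundary_approx[OF t(2) this] show ?thesis by (metis min_less_iff_conj)
  qed
  show "?g ((1/2) *\<^sub>R (x + y)) \<le> (?g x + ?g y) / 2 - \<delta>"
  proof (rule field_le_epsilon)
    fix e :: real
    assume e: "0 < e"
    obtain s where s: "(x, s) \<in> H" "s < b" "s < ?g x + e" using near[OF x e] by blast
    obtain t where t: "(y, t) \<in> H" "t < b" "t < ?g y + e" using near[OF y e] by blast
    have "?g ((1/2) *\<^sub>R (x + y)) \<le> (s + t) / 2 - \<delta>"
      using mid[OF x y s(1) t(1) s(2) t(2) far] by (rule lower_boundary_le[OF below])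
    then show "?g ((1/2) *\<^sub>R (x + y)) \<le> (?g x + ?g y) / 2 - \<delta> + e"
      using s(3) t(3) by argo
  qed
qed

section \<open>The convex envelope of a uniformly convex function\<close>

text \<open>
  Write \<open>H\<close> for the convex hull of the epigraph. The gain is measured by
  \<open>c * (norm (x - y) - \<epsilon>)\<close>, an expression convex in \<open>x\<close> and in \<open>y\<close>: so the points of \<open>H\<close> which
  satisfy the midpoint inequality against a fixed point form a convex set, and it suffices to check
  the epigraph itself. There the expression is at most \<open>\<delta>\<close> for \<open>c\<close> small, and it is negative for the
  pairs about which \<open>\<epsilon>\<close>-uniform convexity says nothing.
\<close>

lemma convex_envelope_uniformly_convex:
  fixes f :: "'a::real_normed_vector \<Rightarrow> real"
  assumes C: "convex C" "bounded C" and bdd: "bounded (f ` C)"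
    and uc: "eps_uniformly_convex_on \<epsilon> C f" and \<epsilon>: "0 < \<epsilon>" "\<epsilon> < \<epsilon>'"
  shows "\<exists>g. bounded (g ` C) \<and> eps_uniformly_convex_on \<epsilon>' C g \<and> convex_on C g"
proof -
  obtain M where M: "\<And>x. x \<in> C \<Longrightarrow> \<bar>f x\<bar> \<le> M"
    using bdd by (auto simp: bounded_iff)
  obtain \<delta> where \<delta>: "\<delta> > 0" and
    mid: "\<And>x y. x \<in> C \<Longrightarrow> y \<in> C \<Longrightarrow> norm (x - y) \<ge> \<epsilon>
      \<Longrightarrow> f ((1/2) *\<^sub>R (x + y)) \<le> (f x + f y) / 2 - \<delta>"
    using uc by (auto simp: eps_uniformly_convex_on_def)
  obtain r where r: "r > 0" "\<And>x. x \<in> C \<Longrightarrow> norm x \<le> r"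
    using C(2) by (auto simp: bounded_pos)
  define c where "c = \<delta> / (2 * r)"
  have c: "c > 0" using \<delta> r(1) by (simp add: c_def)
  have gain_le: "c * (norm (x - y) - \<epsilon>) \<le> \<delta>" if "x \<in> C" "y \<in> C" for x y
  proof -
    have "norm (x - y) - \<epsilon> \<le> 2 * r"
      using norm_triangle_ineq4[of x y] r(2)[OF that(1)] r(2)[OF that(2)] \<epsilon> by linarith
    then have "c * (norm (x - y) - \<epsilon>) \<le> c * (2 * r)" using c by (intro mult_left_mono) auto
    then show ?thesis using r(1) by (simp add: c_def)
  qed
  define E where "E = epigraph C f"
  define H where "H = convex hull E"
  have H: "convex H" unfolding H_def by (rule convex_convex_hull)
  have E_H: "p \<in> H" if "p \<in> E" for p using that unfolding H_def by (rule hull_inc)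
  have below: "H \<subseteq> UNIV \<times> {- M..}"
    unfolding H_def
  proof (rule hull_minimal)
    show "E \<subseteq> UNIV \<times> {- M..}"
      using M by (fastforce simp: E_def epigraph_def)
  qed (intro convex_Times convex_UNIV convex_real_interval)
  have upward: "(x, t') \<in> H" if "(x, t) \<in> H" "t \<le> t'" for x t t'
  proof -
    have "(+) (0, t' - t) ` E \<subseteq> E"
      using that(2) by (auto simp: E_def epigraph_def)
    then have "(+) (0, t' - t) ` H \<subseteq> H"
      unfolding H_def by (metis convex_hull_translation hull_mono)
    then have "(0, t' - t) + (x, t) \<in> H" using that(1) by blast
    then show ?thesis by simp
  qed
  define P where "P p q \<longleftrightarrow> ((1/2) *\<^sub>R (fst p + fst q),
      (snd p + snd q) / 2 - c * (norm (fst p - fst q) - \<epsilon>)) \<in> H" for p q :: "'a \<times> real"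
  have P_commute: "P p q \<longleftrightarrow> P q p" for p q
    unfolding P_def by (simp add: add.commute norm_minus_commute)
  have P_convex: "convex {p. P p q}" for q
    unfolding convex_def
  proof (intro ballI allI impI, unfold mem_Collect_eq)
    fix p p' and u v :: real
    assume p: "P p q" and p': "P p' q" and uv: "0 \<le> u" "0 \<le> v" "u + v = 1"
    define w where "w = u *\<^sub>R p + v *\<^sub>R p'"
    define s where "s = u * ((snd p + snd q) / 2 - c * (norm (fst p - fst q) - \<epsilon>))
        + v * ((snd p' + snd q) / 2 - c * (norm (fst p' - fst q) - \<epsilon>))"
    have u: "u = 1 - v" using uv(3) by simp
    have "fst w + fst q = u *\<^sub>R (fst p + fst q) + v *\<^sub>R (fst p' + fst q)"
      by (simp add: w_def u algebra_simps)
    then have "u *\<^sub>R ((1/2) *\<^sub>R (fst p + fst q)) + v *\<^sub>R ((1/2) *\<^sub>R (fst p' + fst q))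
        = (1/2) *\<^sub>R (fst w + fst q)"
      by (simp add: scaleR_right_distrib)
    then have "((1/2) *\<^sub>R (fst w + fst q), s) \<in> H"
      using convexD[OF H p[unfolded P_def] p'[unfolded P_def] uv] by (simp add: s_def)
    moreover have "s \<le> (snd w + snd q) / 2 - c * (norm (fst w - fst q) - \<epsilon>)"
    proof -
      have "fst w - fst q = u *\<^sub>R (fst p - fst q) + v *\<^sub>R (fst p' - fst q)"
        by (simp add: w_def u algebra_simps)
      then have "norm (fst w - fst q) \<le> u * norm (fst p - fst q) + v * norm (fst p' - fst q)"
        using uv norm_triangle_ineq[of "u *\<^sub>R (fst p - fst q)" "v *\<^sub>R (fst p' - fst q)"] by simp
      then have "c * norm (fst w - fst q)
          \<le> c * (u * norm (fst p - fst q) + v * norm (fst p' - fst q))"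
        using c by (intro mult_left_mono) auto
      then show ?thesis by (simp add: s_def w_def u algebra_simps add_divide_distrib diff_divide_distrib)
    qed
    ultimately show "P (u *\<^sub>R p + v *\<^sub>R p') q"
      unfolding P_def w_def[symmetric] by (rule upward)
  qed
  have P_E: "P p q" if p: "p \<in> E" and q: "q \<in> E" for p q
  proof -
    obtain x s where xs: "p = (x, s)" "x \<in> C" "f x \<le> s"
      using p by (cases p) (auto simp: E_def epigraph_def)
    obtain y t where yt: "q = (y, t)" "y \<in> C" "f y \<le> t"
      using q by (cases q) (auto simp: E_def epigraph_def)
    have m: "(1/2) *\<^sub>R (x + y) \<in> C"
      using convexD[OF C(1) xs(2) yt(2), of "1/2" "1/2"] by (simp add: scaleR_add_right)
    show ?thesis
    proof (cases "norm (x - y) \<ge> \<epsilon>")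
      case True
      have "f ((1/2) *\<^sub>R (x + y)) \<le> (s + t) / 2 - c * (norm (x - y) - \<epsilon>)"
        using mid[OF xs(2) yt(2) True] gain_le[OF xs(2) yt(2)] xs(3) yt(3) by argo
      then show ?thesis
        using m E_H[of "((1/2) *\<^sub>R (x + y), (s + t) / 2 - c * (norm (x - y) - \<epsilon>))"]
        by (simp add: P_def xs(1) yt(1) E_def epigraph_def)
    next
      case False
      have "(1/2) *\<^sub>R p + (1/2) *\<^sub>R q \<in> H"
        using p q E_H by (intro convexD[OF H]) auto
      then have "((1/2) *\<^sub>R (x + y), (s + t) / 2) \<in> H"
        by (simp add: xs(1) yt(1) scaleR_add_right add_divide_distrib)
      moreover have "c * (norm (x - y) - \<epsilon>) \<le> 0"
        using False c by (intro mult_nonneg_nonpos) auto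
      ultimately show ?thesis unfolding P_def xs(1) yt(1) fst_conv snd_conv
        by (elim upward) linarith
    qed
  qed
  have P_HE: "P p q" if p: "p \<in> H" and q: "q \<in> E" for p q
  proof -
    have "E \<subseteq> {p. P p q}" using P_E q by blast
    then have "H \<subseteq> {p. P p q}" unfolding H_def using P_convex by (rule hull_minimal)
    then show ?thesis using p by blast
  qed
  have P_H: "P p q" if p: "p \<in> H" and q: "q \<in> H" for p q
  proof -
    have "E \<subseteq> {p. P p q}" using P_HE[OF q] P_commute by blast
    then have "H \<subseteq> {p. P p q}" unfolding H_def using P_convex by (rule hull_minimal)
    then show ?thesis using p by blast
  qed
  have graph: "\<forall>x\<in>C. \<exists>t<M + 1. (x, t) \<in> H"
  proof
    fix x
    assume x: "x \<in> C"
    then have "(x, f x) \<in> H" by (intro E_H) (simp add: E_def epigraph_def)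
    moreover have "f x < M + 1" using M[OF x] by linarith
    ultimately show "\<exists>t<M + 1. (x, t) \<in> H" by blast
  qed
  have "eps_uniformly_convex_on \<epsilon>' C (lower_boundary H)"
  proof (rule uniformly_convex_lower_boundary[where \<delta> = "c * (\<epsilon>' - \<epsilon>)"])
    show "0 < c * (\<epsilon>' - \<epsilon>)" using c \<epsilon> by simp
    fix x y s t
    assume xy: "(x, s) \<in> H" "(y, t) \<in> H" and far: "norm (x - y) \<ge> \<epsilon>'"
    have "c * (\<epsilon>' - \<epsilon>) \<le> c * (norm (x - y) - \<epsilon>)"
      using far c by (intro mult_left_mono) auto
    with P_H[OF xy] show "((1/2) *\<^sub>R (x + y), (s + t) / 2 - c * (\<epsilon>' - \<epsilon>)) \<in> H"
      unfolding P_def fst_conv snd_conv by (elim upward) linarith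
  qed (fact below graph)+
  moreover have "convex_on C (lower_boundary H)"
    using graph by (intro convex_on_lower_boundary[OF C(1) H below]) blast+
  ultimately show ?thesis using bounded_lower_boundary[OF below graph] by blast
qed

section \<open>Lipschitz regularization\<close>

lemma infimal_convolution_uniformly_convex:
  fixes f :: "'a::real_normed_vector \<Rightarrow> real"
  assumes f: "convex_on C f" and bdd: "bounded (f ` C)"
    and uc: "eps_uniformly_convex_on \<epsilon> C f" and \<epsilon>: "\<epsilon> < \<epsilon>'"
  shows "\<exists>g. bounded (g ` C) \<and> eps_uniformly_convex_on \<epsilon>' C g \<and> convex_on C g
    \<and> (\<exists>L. L-lipschitz_on C g)"
proof -
  have C: "convex C" using f by (rule convex_on_imp_convex)
  obtain M where M0: "M > 0" and M: "\<And>x. x \<in> C \<Longrightarrow> \<bar>f x\<bar> \<le> M"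
    using bdd by (auto simp: bounded_pos)
  obtain \<delta> where \<delta>: "\<delta> > 0" and
    mid: "\<And>x y. x \<in> C \<Longrightarrow> y \<in> C \<Longrightarrow> norm (x - y) \<ge> \<epsilon>
      \<Longrightarrow> f ((1/2) *\<^sub>R (x + y)) \<le> (f x + f y) / 2 - \<delta>"
    using uc by (auto simp: eps_uniformly_convex_on_def)
  \<comment> \<open>On \<open>C\<close> the infimal convolution is at most \<open>M\<close>; where \<open>f z + K * norm (x - z)\<close> stays below
    \<open>M + 1\<close>, this choice of \<open>K\<close> forces \<open>z\<close> to lie within \<open>(\<epsilon>' - \<epsilon>) / 2\<close> of \<open>x\<close>.\<close>
  define K where "K = 2 * (2 * M + 1) / (\<epsilon>' - \<epsilon>)"
  have K: "K > 0" using M0 \<epsilon> by (simp add: K_def)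
  define H where "H = {(x, t). \<exists>z\<in>C. f z + K * norm (x - z) \<le> t}"
  have below: "H \<subseteq> UNIV \<times> {- M..}"
  proof
    fix p
    assume "p \<in> H"
    then obtain x t z where z: "p = (x, t)" "z \<in> C" "f z + K * norm (x - z) \<le> t"
      by (auto simp: H_def)
    have "0 \<le> K * norm (x - z)" using K by simp
    then have "- M \<le> t" using M[OF z(2)] z(3) by linarith
    then show "p \<in> UNIV \<times> {- M..}" by (simp add: z(1))
  qed
  have graph: "\<forall>x\<in>C. \<exists>t<M + 1. (x, t) \<in> H"
  proof
    fix x
    assume x: "x \<in> C"
    then have "(x, f x) \<in> H" by (auto simp: H_def intro!: bexI[of _ x])
    moreover have "f x < M + 1" using M[OF x] by linarith
    ultimately show "\<exists>t<M + 1. (x, t) \<in> H" by blast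
  qed
  have combine: "\<exists>z\<in>C. z = u *\<^sub>R z1 + v *\<^sub>R z2 \<and>
      K * norm (u *\<^sub>R x + v *\<^sub>R y - z) \<le> u * (K * norm (x - z1)) + v * (K * norm (y - z2))"
    if z: "z1 \<in> C" "z2 \<in> C" and uv: "0 \<le> u" "0 \<le> v" "u + v = 1" for z1 z2 x y and u v :: real
  proof (intro bexI conjI)
    have "u *\<^sub>R x + v *\<^sub>R y - (u *\<^sub>R z1 + v *\<^sub>R z2) = u *\<^sub>R (x - z1) + v *\<^sub>R (y - z2)"
      by (simp add: algebra_simps)
    then have "norm (u *\<^sub>R x + v *\<^sub>R y - (u *\<^sub>R z1 + v *\<^sub>R z2))
        \<le> u * norm (x - z1) + v * norm (y - z2)"
      using uv norm_triangle_ineq[of "u *\<^sub>R (x - z1)" "v *\<^sub>R (y - z2)"] by simp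
    then have "K * norm (u *\<^sub>R x + v *\<^sub>R y - (u *\<^sub>R z1 + v *\<^sub>R z2))
        \<le> K * (u * norm (x - z1) + v * norm (y - z2))"
      using K by (intro mult_left_mono) auto
    then show "K * norm (u *\<^sub>R x + v *\<^sub>R y - (u *\<^sub>R z1 + v *\<^sub>R z2))
        \<le> u * (K * norm (x - z1)) + v * (K * norm (y - z2))"
      by (simp add: algebra_simps)
    show "u *\<^sub>R z1 + v *\<^sub>R z2 \<in> C" using convexD[OF C z uv] .
  qed simp
  have H: "convex H"
    unfolding convex_def
  proof (intro ballI allI impI)
    fix p q and u v :: real
    assume p: "p \<in> H" and q: "q \<in> H" and uv: "0 \<le> u" "0 \<le> v" "u + v = 1"
    obtain x s z1 where z1: "p = (x, s)" "z1 \<in> C" "f z1 + K * norm (x - z1) \<le> s"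
      using p by (auto simp: H_def)
    obtain y t z2 where z2: "q = (y, t)" "z2 \<in> C" "f z2 + K * norm (y - z2) \<le> t"
      using q by (auto simp: H_def)
    obtain z where z: "z \<in> C" "z = u *\<^sub>R z1 + v *\<^sub>R z2"
      "K * norm (u *\<^sub>R x + v *\<^sub>R y - z) \<le> u * (K * norm (x - z1)) + v * (K * norm (y - z2))"
      using combine[OF z1(2) z2(2) uv] by blast
    have "f z \<le> u * f z1 + v * f z2"
      using f z1(2) z2(2) uv unfolding z(2) convex_on_def by blast
    then have "f z + K * norm (u *\<^sub>R x + v *\<^sub>R y - z)
        \<le> u * (f z1 + K * norm (x - z1)) + v * (f z2 + K * norm (y - z2))"
      using z(3) by (simp add: algebra_simps)
    also have "\<dots> \<le> u * s + v * t"
      using z1(3) z2(3) uv by (intro add_mono mult_left_mono) auto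
    finally show "u *\<^sub>R p + v *\<^sub>R q \<in> H"
      using z(1) by (auto simp: H_def z1(1) z2(1))
  qed
  have close: "norm (x - z) < (\<epsilon>' - \<epsilon>) / 2"
    if "z \<in> C" "f z + K * norm (x - z) \<le> t" "t < M + 1" for x z t
  proof -
    have "K * norm (x - z) < 2 * M + 1" using that M[of z] by fastforce
    also have "\<dots> = K * ((\<epsilon>' - \<epsilon>) / 2)" using \<epsilon> by (simp add: K_def)
    finally show ?thesis using K by simp
  qed
  have "eps_uniformly_convex_on \<epsilon>' C (lower_boundary H)"
  proof (rule uniformly_convex_lower_boundary)
    show "0 < \<delta>" by (fact \<delta>)
    fix x y s t
    assume xs: "(x, s) \<in> H" "s < M + 1" and yt: "(y, t) \<in> H" "t < M + 1"
      and far: "norm (x - y) \<ge> \<epsilon>'"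
    obtain z1 where z1: "z1 \<in> C" "f z1 + K * norm (x - z1) \<le> s"
      using xs(1) by (auto simp: H_def)
    obtain z2 where z2: "z2 \<in> C" "f z2 + K * norm (y - z2) \<le> t"
      using yt(1) by (auto simp: H_def)
    have "norm (x - y) \<le> norm (x - z1) + norm (z1 - z2) + norm (y - z2)"
      using norm_triangle_ineq[of "x - z1" "z1 - y"] norm_triangle_ineq[of "z1 - z2" "z2 - y"]
      by (simp add: norm_minus_commute[of z2 y])
    then have "norm (z1 - z2) \<ge> \<epsilon>"
      using far close[OF z1 xs(2)] close[OF z2 yt(2)] by argo
    note gain = mid[OF z1(1) z2(1) this]
    obtain z where z: "z \<in> C" "z = (1/2) *\<^sub>R z1 + (1/2) *\<^sub>R z2"
      "K * norm ((1/2) *\<^sub>R x + (1/2) *\<^sub>R y - z)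
        \<le> (1/2) * (K * norm (x - z1)) + (1/2) * (K * norm (y - z2))"
      using combine[OF z1(1) z2(1), of "1/2" "1/2" x y] by auto
    have "f z \<le> (f z1 + f z2) / 2 - \<delta>"
      using gain by (simp add: z(2) scaleR_add_right)
    then have "f z + K * norm ((1/2) *\<^sub>R x + (1/2) *\<^sub>R y - z) \<le> (s + t) / 2 - \<delta>"
      using z(3) z1(2) z2(2) by argo
    then show "((1/2) *\<^sub>R (x + y), (s + t) / 2 - \<delta>) \<in> H"
      using z(1) by (auto simp: H_def scaleR_add_right)
  qed (fact below graph)+
  moreover have "convex_on C (lower_boundary H)"
    using graph by (intro convex_on_lower_boundary[OF C H below]) blast+
  moreover have "K-lipschitz_on C (lower_boundary H)"
  proof (rule lipschitz_onI)
    let ?g = "lower_boundary H"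
    have one_sided: "?g y - ?g x \<le> K * norm (x - y)" if x: "x \<in> C" for x y
    proof (rule field_le_epsilon)
      fix e :: real
      assume "0 < e"
      then obtain t where t: "(x, t) \<in> H" "t < ?g x + e"
        using graph x lower_boundary_approx[of x _ H "?g x + e"] by auto
      obtain z where z: "z \<in> C" "f z + K * norm (x - z) \<le> t" using t(1) by (auto simp: H_def)
      have "norm (y - z) \<le> norm (x - z) + norm (x - y)"
        using norm_triangle_ineq[of "y - x" "x - z"] by (simp add: norm_minus_commute)
      then have "K * norm (y - z) \<le> K * (norm (x - z) + norm (x - y))"
        using K by (intro mult_left_mono) auto
      then have "(y, t + K * norm (x - y)) \<in> H"
        using z by (auto simp: H_def distrib_left intro!: bexI[of _ z])
      then have "?g y \<le> t + K * norm (x - y)" by (rule lower_boundary_le[OF below])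
      then show "?g y - ?g x \<le> K * norm (x - y) + e" using t(2) by linarith
    qed
    show "dist (?g x) (?g y) \<le> K * dist x y" if "x \<in> C" "y \<in> C" for x y
      using one_sided[OF that(1), of y] one_sided[OF that(2), of x]
      by (simp add: dist_norm norm_minus_commute abs_le_iff)
  qed (use K in simp)
  ultimately show ?thesis using bounded_lower_boundary[OF below graph] by blast
qed

section \<open>Equality of the three infima\<close>

lemma Inf_eq_if_right_approximated:
  fixes A B :: "real set"
  assumes sub: "A \<subseteq> B" and below: "\<And>x. x \<in> B \<Longrightarrow> m \<le> x"
    and approx: "\<And>x y. x \<in> B \<Longrightarrow> x < y \<Longrightarrow> y \<in> A"
  shows "Inf B = Inf A"
proof (cases "B = {}")
  case True
  then show ?thesis using sub by simp
next
  case False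
  then have A: "A \<noteq> {}" using approx less_add_one by blast
  have bdd: "bdd_below B" using below by (rule bdd_belowI)
  then have "bdd_below A" using sub by (rule bdd_below_mono)
  have "Inf A \<le> x" if x: "x \<in> B" for x
  proof (rule dense_ge)
    fix y
    assume "x < y"
    then show "Inf A \<le> y" by (intro cInf_lower approx[OF x] \<open>bdd_below A\<close>)
  qed
  then have "Inf A \<le> Inf B" using False by (intro cInf_greatest)
  then show ?thesis using cInf_superset_mono[OF A bdd sub] by simp
qed

theorem theorem1p5:
  fixes C :: "'a::banach set"
  assumes "C \<noteq> {}" and "closed C" and "bounded C" and "convex C"
  shows "Inf {\<epsilon>::real. \<epsilon> > 0 \<and> bounded_tree_heights \<epsilon> C}
           = Inf {\<epsilon>::real. \<epsilon> > 0 \<and>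
               (\<exists>f::'a \<Rightarrow> real. bounded (f ` C) \<and> eps_uniformly_convex_on \<epsilon> C f)}
       \<and> Inf {\<epsilon>::real. \<epsilon> > 0 \<and>
               (\<exists>f::'a \<Rightarrow> real. bounded (f ` C) \<and> eps_uniformly_convex_on \<epsilon> C f)}
           = Inf {\<epsilon>::real. \<epsilon> > 0 \<and>
               (\<exists>f::'a \<Rightarrow> real. bounded (f ` C) \<and> eps_uniformly_convex_on \<epsilon> C f \<and>
                  convex_on C f \<and> (\<exists>L. L-lipschitz_on C f))}"
    (is "Inf ?A = Inf ?B \<and> Inf ?B = Inf ?D")
proof
  have "bounded_tree_heights \<epsilon> C
      \<longleftrightarrow> (\<exists>f::'a \<Rightarrow> real. bounded (f ` C) \<and> eps_uniformly_convex_on \<epsilon> C f)" for \<epsilon>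
    using uniformly_convex_function_of_bounded_trees[OF assms(4)]
      bounded_tree_heights_if_uniformly_convex by blast
  then show "Inf ?A = Inf ?B" by simp
  show "Inf ?B = Inf ?D"
  proof (rule Inf_eq_if_right_approximated[where m = 0])
    fix \<epsilon> \<epsilon>'' :: real
    assume \<epsilon>: "\<epsilon> \<in> ?B" and less: "\<epsilon> < \<epsilon>''"
    \<comment> \<open>Each of the two regularizations uses up a part of the margin.\<close>
    obtain \<epsilon>' where \<epsilon>': "\<epsilon> < \<epsilon>'" "\<epsilon>' < \<epsilon>''" using dense[OF less] by blast
    obtain f :: "'a \<Rightarrow> real" where "bounded (f ` C)" "eps_uniformly_convex_on \<epsilon> C f"
      using \<epsilon> by blast
    then obtain g :: "'a \<Rightarrow> real" where
      "bounded (g ` C)" "eps_uniformly_convex_on \<epsilon>' C g" "convex_on C g"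
      using convex_envelope_uniformly_convex[OF assms(4,3) _ _ _ \<epsilon>'(1)] \<epsilon> by blast
    then show "\<epsilon>'' \<in> ?D"
      using infimal_convolution_uniformly_convex[OF _ _ _ \<epsilon>'(2)] \<epsilon> less by auto
  qed auto
qed

end
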